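(* Let $G$ be a simple graph with vertex set $[n]$, let $P_G\subseteq\mathbb{R}^n$ be its graph associahedron, and let $\lambda:\mathbb{R}^n\to\mathbb{R}$ be the linear functional $\lambda(x_1,\dots,x_n)=nx_1+(n-1)x_2+\cdots+x_n$. Then the pair $(P_G,\lambda)$ has the non-revisiting chain property.
   Context: A tube of $G$ is a nonempty subset $I\subseteq[n]=\{1,\dots,n\}$ such that the induced subgraph $G|_I$ is connected. For $I\subseteq[n]$ let $\Delta_I=\mathrm{conv}\{\mathbf{e}_i: i\in I\}$, where $\mathbf{e}_1,\dots,\mathbf{e}_n$ is the standard basis of $\mathbb{R}^n$. The graph associahedron is the Minkowski sum $P_G=\sum_I\Delta_I$ over all tubes $I$ of $G$. For a polytope $P\subseteq\mathbb{R}^n$, a linear functional $\lambda$ is generic if it is not constant on any edge of $P$ (the functional in the claim is generic for $P_G$). For $\lambda$ generic, $L(P,\lambda)$ is the poset on the vertices of $P$ where $v\le w$ if there is a sequence of vertices $v=v_0,v_1,\dots,v_l=w$ with $\lambda(v_0)<\lambda(v_1)<\cdots<\lambda(v_l)$ and each $[v_{i-1},v_i]$ an edge of $P$. The pair $(P,\lambda)$ has the non-revisiting chain property if whenever $\mathbf{x}<\mathbf{y}<\mathbf{z}$ in $L(P,\lambda)$ and $\mathbf{x},\mathbf{z}$ lie in a common face $F$ of $P$, then $\mathbf{y}\in F$. *)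

theory Defs
  imports "HOL-Analysis.Analysis" "Graph_Theory.Digraph_Component"
begin

(* Digraph_Component.connected is graph connectedness; the bare name would be ambiguous
   with topological connectedness. *)
definition tubes :: "('v, 'b) pre_digraph \<Rightarrow> 'v set set" where
  "tubes G = {I. I \<noteq> {} \<and> I \<subseteq> verts G \<and> Digraph_Component.connected (induce_subgraph G I)}"

(* The vector e i plays the role of the i-th standard basis vector. The outer sum is
   a Minkowski sum: it uses the addition on sets from HOL-Library.Set_Algebras. *)
definition graph_associahedron ::
    "('v \<Rightarrow> 'a::euclidean_space) \<Rightarrow> ('v, 'b) pre_digraph \<Rightarrow> 'a set" where
  "graph_associahedron e G = (\<Sum>I\<in>tubes G. convex hull (e ` I))"

(* The order of L(P, lam); the case l = 0 gives reflexivity on the vertices of P. *)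
definition L_le :: "'a::euclidean_space set \<Rightarrow> ('a \<Rightarrow> real) \<Rightarrow> 'a \<Rightarrow> 'a \<Rightarrow> bool" where
  "L_le P lam v w \<longleftrightarrow>
     (\<exists>(u :: nat \<Rightarrow> 'a) l. u 0 = v \<and> u l = w \<and>
        (\<forall>i\<le>l. u i extreme_point_of P) \<and>
        (\<forall>i<l. lam (u i) < lam (u (Suc i)) \<and> closed_segment (u i) (u (Suc i)) edge_of P))"

definition L_less :: "'a::euclidean_space set \<Rightarrow> ('a \<Rightarrow> real) \<Rightarrow> 'a \<Rightarrow> 'a \<Rightarrow> bool" where
  "L_less P lam v w \<longleftrightarrow> L_le P lam v w \<and> v \<noteq> w"

(* Meant for a polytope P and a linear functional lam that is not constant on any edge of P;
   the formula itself makes sense without genericity. *)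
definition non_revisiting_chain_property ::
    "'a::euclidean_space set \<Rightarrow> ('a \<Rightarrow> real) \<Rightarrow> bool" where
  "non_revisiting_chain_property P lam \<longleftrightarrow>
     (\<forall>x y z F. L_less P lam x y \<and> L_less P lam y z \<and> F face_of P \<and> x \<in> F \<and> z \<in> F \<longrightarrow> y \<in> F)"

end

theory Submission
  imports Defs
begin

text \<open>
  A vertex of a Minkowski sum of simplices \<open>\<Delta>\<^sub>I\<close> selects one element \<open>\<sigma> I\<close> of every \<open>I\<close>.
  Along an edge \<open>[v, w]\<close> every summand moves parallel to \<open>w - v\<close>, in the same direction, so
  \<open>\<lambda>\<close> is monotone in each summand separately: along an increasing edge path the vertex selected from
  \<open>\<Delta>\<^sub>I\<close> either stays or moves to a strictly larger value of \<open>\<lambda>\<close>, so if it is the same at both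
  ends it is constant.

  Let the face \<open>F\<close> maximise \<open>a\<close>, let \<open>x < y < z\<close> with \<open>x, z \<in> F\<close>, and suppose \<open>y \<notin> F\<close>. Then for
  some tube \<open>I\<close> the selection \<open>t\<close> of \<open>y\<close> does not maximise \<open>a\<close> on \<open>I\<close>. Walking inside \<open>I\<close> from \<open>t\<close>
  to a maximiser until the value of \<open>a\<close> first exceeds \<open>a t\<close> gives a tube \<open>J \<subseteq> I\<close> containing \<open>t\<close>
  on which \<open>a\<close> has a unique maximiser \<open>b \<noteq> t\<close>. Both \<open>x\<close> and \<open>z\<close> select \<open>b\<close> from \<open>J\<close>, hence so
  does \<open>y\<close>; but a vertex selecting \<open>t\<close> from \<open>I\<close> also selects \<open>t\<close> from \<open>J\<close>.
\<close>

section \<open>Minkowski sums of convex hulls\<close>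

lemma selection_sum_mem:
  fixes e :: "'v \<Rightarrow> 'a::real_vector"
  assumes "finite T" "\<And>I. I \<in> T \<Longrightarrow> \<tau> I \<in> I"
  shows "(\<Sum>I\<in>T. e (\<tau> I)) \<in> (\<Sum>I\<in>T. convex hull (e ` I))"
  unfolding set_sum_alt[OF assms(1)] using assms(2) by (fastforce intro: hull_inc)

text \<open>Supplies the test points for the exchange arguments and for the supporting functional of
  a face.\<close>

lemma selection_sum_upd_mem:
  fixes e :: "'v \<Rightarrow> 'a::real_vector"
  assumes "finite T" "\<And>K. K \<in> T \<Longrightarrow> \<tau> K \<in> K" "I \<in> T" "i \<in> I"
  shows "(\<Sum>K\<in>T. e (\<tau> K)) + (e i - e (\<tau> I)) \<in> (\<Sum>K\<in>T. convex hull (e ` K))"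
proof -
  have "(\<Sum>K\<in>T - {I}. e ((\<tau>(I := i)) K)) = (\<Sum>K\<in>T - {I}. e (\<tau> K))"
    by (rule sum.cong) auto
  then have "(\<Sum>K\<in>T. e ((\<tau>(I := i)) K)) = (\<Sum>K\<in>T. e (\<tau> K)) + (e i - e (\<tau> I))"
    by (simp add: sum.remove[OF assms(1,3)])
  then show ?thesis
    using selection_sum_mem[of T "\<tau>(I := i)" e] assms by (metis fun_upd_apply)
qed

text \<open>Adding the other summands translates a segment of \<open>S J\<close> around
  \<open>s J\<close> to a segment of the Minkowski sum around the total.\<close>

lemma sum_extreme_point_summand:
  fixes S :: "'i \<Rightarrow> 'a::real_vector set"
  assumes "finite T" "(\<Sum>I\<in>T. s I) extreme_point_of (\<Sum>I\<in>T. S I)"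
    and s: "\<And>I. I \<in> T \<Longrightarrow> s I \<in> S I" and J: "J \<in> T"
  shows "s J extreme_point_of S J"
  unfolding extreme_point_of_def
proof (intro conjI ballI notI)
  show "s J \<in> S J" using s J .
next
  fix a b assume ab: "a \<in> S J" "b \<in> S J" "s J \<in> open_segment a b"
  define R where "R = (\<Sum>I\<in>T - {J}. s I)"
  have mem: "R + c \<in> (\<Sum>I\<in>T. S I)" if "c \<in> S J" for c
  proof -
    have "(\<Sum>I\<in>T. (s(J := c)) I) = c + (\<Sum>I\<in>T - {J}. (s(J := c)) I)"
      using assms(1) J by (simp add: sum.remove)
    also have "(\<Sum>I\<in>T - {J}. (s(J := c)) I) = R"
      unfolding R_def by (rule sum.cong) auto
    finally have "R + c = (\<Sum>I\<in>T. (s(J := c)) I)" by (simp add: add.commute)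
    moreover have "\<forall>I\<in>T. (s(J := c)) I \<in> S I" using s that by simp
    ultimately show ?thesis unfolding set_sum_alt[OF assms(1)] by blast
  qed
  have "(\<Sum>I\<in>T. s I) = R + s J"
    unfolding R_def using assms(1) J by (simp add: sum.remove add.commute)
  also have "\<dots> \<in> open_segment (R + a) (R + b)"
    using ab(3) by (simp add: open_segment_translation_eq)
  finally show False
    using assms(2) mem ab(1,2) unfolding extreme_point_of_def by blast
qed

lemma extreme_point_selection:
  fixes e :: "'v \<Rightarrow> 'a::euclidean_space"
  assumes "finite T" "v extreme_point_of (\<Sum>I\<in>T. convex hull (e ` I))"
  shows "\<exists>\<tau>. (\<forall>I\<in>T. \<tau> I \<in> I) \<and> v = (\<Sum>I\<in>T. e (\<tau> I))"
proof -
  obtain s where v: "v = (\<Sum>I\<in>T. s I)" and s: "\<forall>I\<in>T. s I \<in> convex hull (e ` I)"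
    using assms(2) unfolding extreme_point_of_def set_sum_alt[OF assms(1)] by blast
  have "\<forall>I\<in>T. \<exists>i\<in>I. s I = e i"
    using sum_extreme_point_summand[OF assms(1), of s] assms(2) s v
      extreme_point_of_convex_hull by blast
  then obtain \<tau> where "\<forall>I\<in>T. \<tau> I \<in> I \<and> s I = e (\<tau> I)" by metis
  then show ?thesis using v by auto
qed

text \<open>If the two selections differed, exchanging them would exhibit the vertex as a midpoint.\<close>

lemma extreme_selection_subset:
  fixes e :: "'v \<Rightarrow> 'a::euclidean_space"
  assumes "finite T" and ext: "(\<Sum>I\<in>T. e (\<tau> I)) extreme_point_of (\<Sum>I\<in>T. convex hull (e ` I))"
    and \<tau>: "\<And>I. I \<in> T \<Longrightarrow> \<tau> I \<in> I" and IJ: "I \<in> T" "J \<in> T" "J \<subseteq> I" "\<tau> I \<in> J"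
  shows "e (\<tau> J) = e (\<tau> I)"
proof (rule ccontr)
  assume ne: "e (\<tau> J) \<noteq> e (\<tau> I)"
  define v d where "v = (\<Sum>I\<in>T. e (\<tau> I))" and "d = e (\<tau> J) - e (\<tau> I)"
  \<comment> \<open>\<open>J \<subseteq> I\<close> makes \<open>\<tau> J\<close> an admissible
    choice in \<open>I\<close>; conversely \<open>\<tau> I \<in> J\<close> permits the opposite
    change in \<open>J\<close>.\<close>
  have "v + d \<in> (\<Sum>I\<in>T. convex hull (e ` I))"
    unfolding v_def d_def using \<tau> IJ assms(1) by (intro selection_sum_upd_mem) auto
  moreover have "v - d \<in> (\<Sum>I\<in>T. convex hull (e ` I))"
    using selection_sum_upd_mem[OF assms(1) \<tau> IJ(2,4), of e]
    by (simp add: v_def d_def algebra_simps)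
  moreover have "v \<in> open_segment (v + d) (v - d)"
  proof -
    have "midpoint (v + d) (v - d) = v"
      by (simp add: midpoint_def flip: scaleR_2)
    moreover have "v + d \<noteq> v - d"
    proof
      assume "v + d = v - d"
      then have "2 *\<^sub>R d = 0" by (simp add: scaleR_2 algebra_simps)
      then show False using ne by (simp add: d_def)
    qed
    ultimately show ?thesis by (metis midpoint_in_open_segment)
  qed
  ultimately show False using ext unfolding v_def extreme_point_of_def by blast
qed

text \<open>
  Interchanging \<open>\<sigma> I\<close> and \<open>\<tau> I\<close> in \<open>v\<close> and \<open>w\<close> preserves their midpoint, so the face property puts
  the modified points on the segment as well.
\<close>

lemma edge_selection_parallel:
  fixes e :: "'v \<Rightarrow> 'a::euclidean_space"
  assumes "finite T" and face: "closed_segment v w face_of (\<Sum>I\<in>T. convex hull (e ` I))"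
    and \<sigma>: "\<And>I. I \<in> T \<Longrightarrow> \<sigma> I \<in> I" "v = (\<Sum>I\<in>T. e (\<sigma> I))"
    and \<tau>: "\<And>I. I \<in> T \<Longrightarrow> \<tau> I \<in> I" "w = (\<Sum>I\<in>T. e (\<tau> I))"
    and I: "I \<in> T"
  shows "\<exists>c\<ge>0. e (\<tau> I) - e (\<sigma> I) = c *\<^sub>R (w - v)"
proof -
  define d where "d = e (\<tau> I) - e (\<sigma> I)"
  have v': "v + d \<in> (\<Sum>I\<in>T. convex hull (e ` I))"
    unfolding d_def \<sigma>(2) using \<sigma>(1) \<tau>(1) I assms(1) by (intro selection_sum_upd_mem) auto
  have w': "w - d \<in> (\<Sum>I\<in>T. convex hull (e ` I))"
    using selection_sum_upd_mem[OF assms(1) \<tau>(1) I \<sigma>(1)[OF I], of e]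
    by (simp add: \<tau>(2) d_def algebra_simps)
  have mid: "midpoint (v + d) (w - d) = midpoint v w"
    by (simp add: midpoint_def)
  have "v + d \<in> closed_segment v w"
  \<comment> \<open>The face property speaks of open segments, which are empty when the modified
    points coincide; these then equal the midpoint of \<open>v\<close> and \<open>w\<close>.\<close>
  proof (cases "v + d = w - d")
    case True
    then show ?thesis using mid by (metis midpoint_in_closed_segment midpoint_idem)
  next
    case False
    then have "midpoint v w \<in> open_segment (v + d) (w - d)"
      using mid by (metis midpoint_in_open_segment)
    then show ?thesis
      using face_ofD[OF face _ v' w'] midpoint_in_closed_segment by blast
  qed
  then obtain c where "0 \<le> c" "v + d = (1 - c) *\<^sub>R v + c *\<^sub>R w"
    by (auto simp: closed_segment_def)
  then show ?thesis unfolding d_def by (intro exI[of _ c]) (simp add: algebra_simps)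
qed

section \<open>Tubes\<close>

lemma (in sym_digraph) tubes_iff:
  "I \<in> tubes G \<longleftrightarrow>
     I \<noteq> {} \<and> I \<subseteq> verts G \<and> (\<forall>u\<in>I. \<forall>v\<in>I. u \<rightarrow>\<^sup>*\<^bsub>induce_subgraph G I\<^esub> v)"
proof (cases "I \<subseteq> verts G")
  case True
  interpret H: wf_digraph "induce_subgraph G I"
    by (rule wellformed_induce_subgraph)
  have "symmetric (induce_subgraph G I)"
    using induced_graph_imp_symmetric[OF sym_arcs] induced_induce[OF True] by blast
  then show ?thesis
    by (auto simp: tubes_def Digraph_Component.connected_def strongly_connected_def
        H.reachable_mk_symmetric_eq)
qed (auto simp: tubes_def)

lemma (in wf_digraph) reachable_induce_subgraph_mono:
  assumes "u \<rightarrow>\<^sup>*\<^bsub>induce_subgraph G J\<^esub> v" "J \<subseteq> I"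
  shows "u \<rightarrow>\<^sup>*\<^bsub>induce_subgraph G I\<^esub> v"
proof -
  have "arcs_ends (induce_subgraph G J) \<subseteq> arcs_ends (induce_subgraph G I)"
    using assms(2) by (auto simp: arcs_ends_conv)
  then show ?thesis
    using assms unfolding reachable_def by (auto intro: rtrancl_on_mono)
qed

lemma (in sym_digraph) singleton_tube: "v \<in> verts G \<Longrightarrow> {v} \<in> tubes G"
  by (auto simp: tubes_iff reachable_def)

text \<open>The vertex \<open>v\<close> serves as a hub: it reaches, and is reached from, each
  vertex of the enlarged set.\<close>

lemma (in sym_digraph) insert_tube:
  assumes J: "J \<in> tubes G" and v: "v \<in> J" and uv: "u \<rightarrow> v"
  shows "insert u J \<in> tubes G"
proof -
  let ?H = "induce_subgraph G (insert u J)"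
  have sub: "insert u J \<subseteq> verts G" using J uv by (auto simp: tubes_iff)
  interpret H: wf_digraph ?H by (rule wellformed_induce_subgraph)
  have adj: "a \<rightarrow>\<^sup>*\<^bsub>?H\<^esub> b" if "a \<rightarrow> b" "a \<in> insert u J" "b \<in> insert u J" for a b
    using that by (intro H.reachable_adjI) (auto simp: arcs_ends_conv)
  have vu: "v \<rightarrow> u" using uv arcs_ends_symmetric[OF sym_arcs] by blast
  have reach: "a \<rightarrow>\<^sup>*\<^bsub>?H\<^esub> b" if "a \<in> J" "b \<in> J" for a b
    using J that reachable_induce_subgraph_mono[of J a b "insert u J"] by (auto simp: tubes_iff)
  have "a \<rightarrow>\<^sup>*\<^bsub>?H\<^esub> v \<and> v \<rightarrow>\<^sup>*\<^bsub>?H\<^esub> a" if "a \<in> insert u J" for a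
    using that reach adj[OF uv] adj[OF vu] v by blast
  then have "\<forall>a\<in>insert u J. \<forall>b\<in>insert u J. a \<rightarrow>\<^sup>*\<^bsub>?H\<^esub> b"
    by (meson H.reachable_trans)
  then show ?thesis unfolding tubes_iff using sub by blast
qed

text \<open>Induct backwards along a walk in \<open>I\<close> from \<open>t\<close> to
  \<open>s\<close>: a vertex satisfying \<open>Q\<close> starts afresh as a singleton, any other
  joins the tube already built, so the vertex with \<open>Q\<close> stays unique.\<close>

lemma (in sym_digraph) subtube_first_hit:
  assumes "I \<in> tubes G" "t \<in> I" "\<not> Q t" "s \<in> I" "Q s"
  shows "\<exists>J\<in>tubes G. J \<subseteq> I \<and> t \<in> J \<and> (\<exists>b\<in>J. Q b \<and> (\<forall>c\<in>J. Q c \<longrightarrow> c = b))"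
proof -
  let ?H = "induce_subgraph G I"
  have I: "I \<subseteq> verts G" and "t \<rightarrow>\<^sup>*\<^bsub>?H\<^esub> s" using assms by (auto simp: tubes_iff)
  interpret H: wf_digraph ?H by (rule wellformed_induce_subgraph)
  from \<open>t \<rightarrow>\<^sup>*\<^bsub>?H\<^esub> s\<close>
  have "\<exists>J\<in>tubes G. J \<subseteq> I \<and> t \<in> J \<and> (\<exists>b\<in>J. Q b \<and> (\<forall>c\<in>J. Q c \<longrightarrow> c = b))"
  proof (induction rule: H.converse_reachable_induct)
    case base
    show ?case using assms I singleton_tube by (intro bexI[of _ "{s}"]) auto
  next
    case (step u v)
    have uv: "u \<rightarrow> v" "u \<in> I" "v \<in> I"
      using step.hyps by (auto simp: arcs_ends_conv)
    show ?case
    proof (cases "Q u")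
      case True
      then show ?thesis using uv I singleton_tube by (intro bexI[of _ "{u}"]) auto
    next
      case False
      obtain J where "J \<in> tubes G" "J \<subseteq> I" "v \<in> J"
        "\<exists>b\<in>J. Q b \<and> (\<forall>c\<in>J. Q c \<longrightarrow> c = b)"
        using step.IH by blast
      then show ?thesis using uv False insert_tube[of J v u] by (intro bexI[of _ "insert u J"]) auto
    qed
  qed
  then show ?thesis .
qed

section \<open>Non-revisiting chains\<close>

text \<open>Each edge moves a summand by a nonnegative multiple of an edge vector on which
  \<open>lam\<close> is positive; the multiple zero means no move. Selections are compared through
  \<open>e\<close>, as distinct indices may share a vector.\<close>

lemma L_le_selection_mono:
  fixes e :: "'v \<Rightarrow> 'a::euclidean_space"
  defines "P T \<equiv> \<Sum>I\<in>T. convex hull (e ` I)"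
  assumes "finite T" "linear lam" and le: "L_le (P T) lam v w"
    and \<sigma>: "\<And>v. v extreme_point_of P T \<Longrightarrow>
               (\<forall>I\<in>T. \<sigma> v I \<in> I) \<and> v = (\<Sum>I\<in>T. e (\<sigma> v I))"
    and I: "I \<in> T"
  shows "e (\<sigma> v I) = e (\<sigma> w I) \<or> lam (e (\<sigma> v I)) < lam (e (\<sigma> w I))"
proof -
  obtain u l where u: "u 0 = v" "u l = w" "\<And>i. i \<le> l \<Longrightarrow> u i extreme_point_of P T"
    "\<And>i. i < l \<Longrightarrow> lam (u i) < lam (u (Suc i)) \<and> closed_segment (u i) (u (Suc i)) edge_of P T"
    using le unfolding L_le_def by blast
  have "e (\<sigma> (u 0) I) = e (\<sigma> (u k) I) \<or> lam (e (\<sigma> (u 0) I)) < lam (e (\<sigma> (u k) I))"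
    if "k \<le> l" for k
    using that
  proof (induction k)
    case (Suc k)
    have ext: "u k extreme_point_of P T" "u (Suc k) extreme_point_of P T"
      and lt: "lam (u k) < lam (u (Suc k))"
      and face: "closed_segment (u k) (u (Suc k)) face_of P T"
      using u(3,4) Suc.prems by (auto simp: edge_of_def)
    have "\<exists>c\<ge>0. e (\<sigma> (u (Suc k)) I) - e (\<sigma> (u k) I) = c *\<^sub>R (u (Suc k) - u k)"
      by (rule edge_selection_parallel[OF \<open>finite T\<close> face[unfolded P_def]])
        (use \<sigma>[OF ext(1)] \<sigma>[OF ext(2)] I in blast)+
    then obtain c where c: "c \<ge> 0"
      "e (\<sigma> (u (Suc k)) I) - e (\<sigma> (u k) I) = c *\<^sub>R (u (Suc k) - u k)"
      by blast
    have "lam (e (\<sigma> (u (Suc k)) I)) - lam (e (\<sigma> (u k) I)) = c * (lam (u (Suc k)) - lam (u k))"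
      using arg_cong[OF c(2), of lam] \<open>linear lam\<close> by (simp add: linear_diff linear_scale)
    moreover have "c * (lam (u (Suc k)) - lam (u k)) > 0" if "c \<noteq> 0"
      using that c(1) lt by simp
    ultimately show ?case
      using Suc c(2) by (cases "c = 0") auto
  qed simp
  then show ?thesis using u(1,2) by blast
qed

text \<open>The sum of hulls is the hull of a finite set, hence a polyhedron, whose faces are all
  exposed. This yields the functional that cuts out a given face.\<close>

lemma exposed_sum_convex_hull:
  fixes e :: "'v \<Rightarrow> 'a::euclidean_space"
  assumes "finite T" "\<And>I. I \<in> T \<Longrightarrow> finite I"
    and "F face_of (\<Sum>I\<in>T. convex hull (e ` I))"
  shows "F exposed_face_of (\<Sum>I\<in>T. convex hull (e ` I))"
proof -
  have "finite (\<Sum>I\<in>T. e ` I)"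
    using assms(1,2) by (induction T rule: finite_induct) (auto intro: finite_set_plus)
  then have "polyhedron (\<Sum>I\<in>T. convex hull (e ` I))"
    by (metis polyhedron_convex_hull convex_hull_set_sum)
  then show ?thesis using assms(3) exposed_face_of_polyhedron by blast
qed

lemma non_revisiting_graph_associahedron:
  fixes e :: "'v \<Rightarrow> 'a::euclidean_space"
  assumes G: "pseudo_graph G" and lin: "linear lam"
  shows "non_revisiting_chain_property (graph_associahedron e G) lam"
proof -
  interpret pseudo_graph G by fact
  define T where "T = tubes G"
  define P where "P = (\<Sum>I\<in>T. convex hull (e ` I))"
  have TV: "I \<subseteq> verts G" if "I \<in> T" for I using that by (auto simp: T_def tubes_def)
  have finT: "finite T" using TV by (intro finite_subset[of T "Pow (verts G)"]) auto
  have finI: "finite I" if "I \<in> T" for I using TV[OF that] finite_subset[of I "verts G"] by auto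
  have "\<forall>v. \<exists>\<tau>. v extreme_point_of P \<longrightarrow> (\<forall>I\<in>T. \<tau> I \<in> I) \<and> v = (\<Sum>I\<in>T. e (\<tau> I))"
    using extreme_point_selection[OF finT] unfolding P_def by blast
  then obtain \<sigma> where \<sigma>: "\<And>v. v extreme_point_of P \<Longrightarrow>
      (\<forall>I\<in>T. \<sigma> v I \<in> I) \<and> v = (\<Sum>I\<in>T. e (\<sigma> v I))"
    by metis
  have mono: "e (\<sigma> v I) = e (\<sigma> w I) \<or> lam (e (\<sigma> v I)) < lam (e (\<sigma> w I))"
    if "L_le P lam v w" "I \<in> T" for v w I
    using L_le_selection_mono[OF finT lin] that \<sigma> unfolding P_def by blast
  have "y \<in> F" if xy: "L_le P lam x y" and yz: "L_le P lam y z"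
    and F: "F face_of P" "x \<in> F" "z \<in> F" for x y z F
  proof -
    obtain a b where sub: "P \<subseteq> {p. a \<bullet> p \<le> b}" and F_eq: "F = P \<inter> {p. a \<bullet> p = b}"
      using exposed_sum_convex_hull[OF finT finI F(1)[unfolded P_def]]
      unfolding exposed_face_of_def P_def by blast
    have ext: "x extreme_point_of P" "y extreme_point_of P" "z extreme_point_of P"
      using xy yz unfolding L_le_def by (metis le0 order_refl)+
    \<comment> \<open>Changing one choice of a vertex in \<open>F\<close> stays in \<open>P\<close>,
      so it cannot raise \<open>a\<close> above the bound \<open>b\<close> attained on
      \<open>F\<close>.\<close>
    have max: "a \<bullet> e i \<le> a \<bullet> e (\<sigma> v I)"
      if v: "v \<in> F" "v extreme_point_of P" and I: "I \<in> T" "i \<in> I" for v I i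
    proof -
      have "v + (e i - e (\<sigma> v I)) \<in> P"
        using selection_sum_upd_mem[OF finT _ I, of "\<sigma> v" e] \<sigma>[OF v(2)]
        unfolding P_def by metis
      then show ?thesis using sub v(1) F_eq by (auto simp: inner_right_distrib inner_diff_right)
    qed
    \<comment> \<open>Equality in every summand gives
      \<open>a \<bullet> y = a \<bullet> x = b\<close>, which puts \<open>y\<close> in
      \<open>F\<close>.\<close>
    have "a \<bullet> e (\<sigma> x I) = a \<bullet> e (\<sigma> y I)" if I: "I \<in> T" for I
    proof (rule ccontr)
      define t where "t = \<sigma> y I"
      define Q where "Q i \<longleftrightarrow> a \<bullet> e t < a \<bullet> e i" for i
      assume "a \<bullet> e (\<sigma> x I) \<noteq> a \<bullet> e (\<sigma> y I)"
      moreover have tI: "t \<in> I" and xI: "\<sigma> x I \<in> I" using \<sigma> ext I by (auto simp: t_def)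
      ultimately have "Q (\<sigma> x I)" "\<not> Q t"
        using max[OF F(2) ext(1) I tI] by (auto simp: Q_def t_def)
      with tI xI I obtain J s where J: "J \<in> T" "J \<subseteq> I" "t \<in> J"
        and s: "s \<in> J" "Q s" "\<And>c. c \<in> J \<Longrightarrow> Q c \<Longrightarrow> c = s"
        using subtube_first_hit[of I t Q "\<sigma> x I"] unfolding T_def by metis
      \<comment> \<open>By \<open>max\<close> the choice of such a vertex in \<open>J\<close> scores
        at least as high as \<open>s\<close>, so it satisfies \<open>Q\<close>.\<close>
      have sel: "\<sigma> v J = s" if "v \<in> F" "v extreme_point_of P" for v
      proof (rule s(3))
        show "\<sigma> v J \<in> J" using \<sigma>[OF that(2)] J(1) by blast
        show "Q (\<sigma> v J)" using max[OF that J(1) s(1)] s(2) by (simp add: Q_def)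
      qed
      \<comment> \<open>Leaving \<open>e s\<close> on the way to \<open>y\<close> would raise
        \<open>lam\<close> strictly, and the way on to \<open>z\<close> could not bring it
        back.\<close>
      have "e (\<sigma> y J) = e s"
        using mono[OF xy J(1)] mono[OF yz J(1)] sel[OF F(2) ext(1)] sel[OF F(3) ext(3)] by auto
      moreover have "e (\<sigma> y J) = e t"
        unfolding t_def
      proof (rule extreme_selection_subset[OF finT _ _ I J(1,2)])
        show "(\<Sum>I\<in>T. e (\<sigma> y I)) extreme_point_of (\<Sum>I\<in>T. convex hull (e ` I))"
          using \<sigma>[OF ext(2)] ext(2) unfolding P_def by metis
        show "\<sigma> y K \<in> K" if "K \<in> T" for K using \<sigma>[OF ext(2)] that by blast
        show "\<sigma> y I \<in> J" using J(3) by (simp add: t_def)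
      qed
      ultimately show False using s(2) by (simp add: Q_def)
    qed
    then have "(\<Sum>I\<in>T. a \<bullet> e (\<sigma> x I)) = (\<Sum>I\<in>T. a \<bullet> e (\<sigma> y I))"
      by (intro sum.cong) auto
    then have "a \<bullet> x = a \<bullet> y"
      using \<sigma>[OF ext(1)] \<sigma>[OF ext(2)] by (metis inner_sum_right)
    then show ?thesis using F(2) F_eq ext(2) by (auto simp: extreme_point_of_def)
  qed
  then show ?thesis
    unfolding non_revisiting_chain_property_def L_less_def graph_associahedron_def
      P_def T_def by blast
qed

theorem theorem2p18:
  fixes n :: nat
    and e :: "nat \<Rightarrow> 'a::euclidean_space"
    and G :: "(nat, 'b) pre_digraph"
  assumes "bij_betw e {1..n} Basis"
    and "graph G"
    and "verts G = {1..n}"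
  shows "non_revisiting_chain_property (graph_associahedron e G)
           (\<lambda>x. \<Sum>i=1..n. (real n + 1 - real i) * (x \<bullet> e i))"
proof (rule non_revisiting_graph_associahedron)
  show "pseudo_graph G" using assms(2) by (simp add: graph_def)
  show "linear (\<lambda>x. \<Sum>i=1..n. (real n + 1 - real i) * (x \<bullet> e i))"
    by (rule linearI)
      (simp_all add: inner_add_left distrib_left sum.distrib sum_distrib_left mult.left_commute)
qed

end
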